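(* Let $\mathcal{A}$ be a node independent graph generative model on $n$ nodes with overlap $\mathrm{Ov}(\mathcal{A})$. For $\bm{A}$ drawn from $\mathcal{A}$, let $\Delta(\bm{A})$ be the number of triangles in the graph with adjacency matrix $\bm{A}$. Then $$\mathbb{E}[\Delta(\bm{A})] \le \frac{1}{6}n^3\cdot \mathrm{Ov}(\mathcal{A})^{3/2} .$$
   Context: All graphs are undirected, unweighted, node-labeled, on the vertex set $[n]=\{1,\dots,n\}$, without self-loops; a graph is identified with its symmetric adjacency matrix in $\{0,1\}^{n\times n}$ (zero diagonal). A graph generative model is a probability distribution $\mathcal{A}$ over such adjacency matrices. Volume: $\mathrm{Vol}(\mathcal{A}) := \mathbb{E}_{\bm{A}\sim\mathcal{A}}\big[\sum_{i<j}\bm{A}_{ij}\big]$. Overlap: $\mathrm{Ov}(\mathcal{A}) := \dfrac{\mathbb{E}_{\bm{A},\bm{A}'\sim\mathcal{A}}\big[\sum_{i<j}\bm{A}_{ij}\bm{A}'_{ij}\big]}{\mathrm{Vol}(\mathcal{A})}$, where $\bm{A},\bm{A}'$ are two independent samples from $\mathcal{A}$ (defined when $\mathrm{Vol}(\mathcal{A})>0$, which is assumed). Node independent model: a distribution $\mathcal{A}$ for which there exist an embedding space $\mathcal{E}$ (a measurable space), mutually independent (not necessarily identically distributed) random variables $\bm{x_1},\dots,\bm{x_n}\in\mathcal{E}$, and a symmetric (measurable) function $e:\mathcal{E}\times\mathcal{E}\to[0,1]$ such that, for $i<j$, $\bm{A}_{ij}=\bm{A}_{ji}$ is a Bernoulli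 random variable with parameter $e(\bm{x_i},\bm{x_j})$, and the entries $\bm{A}_{ij}$, $i<j$, are mutually independent conditioned on $\bm{x_1},\dots,\bm{x_n}$. A triangle is an unordered set of three distinct, pairwise adjacent nodes. *)

theory Defs
  imports "HOL-Probability.Probability"
begin

type_synonym adj_matrix = "nat \<Rightarrow> nat \<Rightarrow> nat"

(* Entries outside {1..n} x {1..n} are fixed to 0, so that two elements are equal
   exactly when the n x n matrices they encode are equal. *)
definition graphs :: "nat \<Rightarrow> adj_matrix set" where
  "graphs n = {a. (\<forall>i j. a i j \<in> {0, 1}) \<and> (\<forall>i j. a i j = a j i) \<and> (\<forall>i. a i i = 0) \<and>
                  (\<forall>i j. i \<notin> {1..n} \<or> j \<notin> {1..n} \<longrightarrow> a i j = 0)}"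

definition node_pairs :: "nat \<Rightarrow> (nat \<times> nat) set" where
  "node_pairs n = {(i, j). i \<in> {1..n} \<and> j \<in> {1..n} \<and> i < j}"

(* graphs n is finite, so every probability distribution on it is a pmf. *)
definition graph_model :: "nat \<Rightarrow> adj_matrix pmf \<Rightarrow> bool" where
  "graph_model n A \<longleftrightarrow> set_pmf A \<subseteq> graphs n"

definition edge_volume :: "nat \<Rightarrow> adj_matrix pmf \<Rightarrow> real" where
  "edge_volume n A = measure_pmf.expectation A (\<lambda>a. \<Sum>(i, j)\<in>node_pairs n. real (a i j))"

definition overlap :: "nat \<Rightarrow> adj_matrix pmf \<Rightarrow> real" where
  "overlap n A =
     measure_pmf.expectation (pair_pmf A A)
       (\<lambda>(a, a'). \<Sum>(i, j)\<in>node_pairs n. real (a i j) * real (a' i j)) / edge_volume n A"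

definition triangles :: "nat \<Rightarrow> adj_matrix \<Rightarrow> nat set set" where
  "triangles n a = {T. T \<subseteq> {1..n} \<and> card T = 3 \<and> (\<forall>u\<in>T. \<forall>v\<in>T. u \<noteq> v \<longrightarrow> a u v = 1)}"

definition cond_prob_given :: "'w measure \<Rightarrow> 'w measure \<Rightarrow> 'w set \<Rightarrow> 'w \<Rightarrow> real" where
  "cond_prob_given M F S = real_cond_exp M F (indicator S)"

definition cond_indep_vars ::
  "'w measure \<Rightarrow> 'w measure \<Rightarrow> ('i \<Rightarrow> 'b measure) \<Rightarrow> ('i \<Rightarrow> 'w \<Rightarrow> 'b) \<Rightarrow> 'i set \<Rightarrow> bool" where
  "cond_indep_vars M F N X I \<longleftrightarrow>
     (\<forall>i\<in>I. X i \<in> measurable M (N i)) \<and>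
     (\<forall>J B. J \<subseteq> I \<and> J \<noteq> {} \<and> finite J \<and> (\<forall>j\<in>J. B j \<in> sets (N j)) \<longrightarrow>
        (AE w in M. cond_prob_given M F (\<Inter>j\<in>J. X j -` B j \<inter> space M) w =
                    (\<Prod>j\<in>J. cond_prob_given M F (X j -` B j \<inter> space M) w)))"

(* The sigma-algebra on space M generated by X i, i in I. *)
definition generated_algebra ::
  "'w measure \<Rightarrow> 'e measure \<Rightarrow> ('i \<Rightarrow> 'w \<Rightarrow> 'e) \<Rightarrow> 'i set \<Rightarrow> 'w measure" where
  "generated_algebra M E X I =
     vimage_algebra (space M) (\<lambda>w. \<lambda>i\<in>I. X i w) (PiM I (\<lambda>_. E))"

(* The embedding space E and the probability space M carrying the random variables are
   parameters because HOL cannot quantify existentially over their underlying types: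
   "A is node independent" means that this predicate holds for some M and E, of any types.
   G is a random graph with law A, defined jointly with the embeddings x. *)
definition node_independent ::
  "nat \<Rightarrow> 'w measure \<Rightarrow> 'e measure \<Rightarrow> adj_matrix pmf \<Rightarrow> bool" where
  "node_independent n M E A \<longleftrightarrow>
     graph_model n A \<and> prob_space M \<and>
     (\<exists>(x :: nat \<Rightarrow> 'w \<Rightarrow> 'e) (e :: 'e \<Rightarrow> 'e \<Rightarrow> real) (G :: 'w \<Rightarrow> adj_matrix).
        prob_space.indep_vars M (\<lambda>_. E) x {1..n} \<and>
        case_prod e \<in> borel_measurable (E \<Otimes>\<^sub>M E) \<and>
        (\<forall>u\<in>space E. \<forall>v\<in>space E. e u v = e v u \<and> e u v \<in> {0..1}) \<and>
        G \<in> measurable M (count_space UNIV) \<and>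
        distr M (count_space UNIV) G = measure_pmf A \<and>
        (\<forall>(i, j)\<in>node_pairs n.
           AE w in M. cond_prob_given M (generated_algebra M E x {1..n})
                        {w \<in> space M. G w i j = 1} w = e (x i w) (x j w)) \<and>
        cond_indep_vars M (generated_algebra M E x {1..n}) (\<lambda>_. count_space UNIV)
          (\<lambda>(i, j) w. G w i j) (node_pairs n))"

end

theory Submission
  imports Defs
begin

text \<open>
  Conditioning on the embeddings turns the probability of a triangle on \<open>i\<close>, \<open>j\<close>, \<open>k\<close> into the
  integral of \<open>e x y * e y z * e x z\<close> against a product of three laws. Two applications of the
  Cauchy--Schwarz inequality bound it by the product of the \<open>L\<^sup>2\<close> norms of the three factors, and
  \<open>e\<^sup>2 \<le> e\<close> bounds these by the square roots of the edge probabilities. The same inequality for sums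
  bounds the sum over all \<open>i\<close>, \<open>j\<close>, \<open>k\<close> (which counts each triangle six times) by
  \<open>(2 Vol)\<^bsup>3/2\<^esup>\<close>. Finally \<open>2 Vol \<le> n\<^sup>2 Ov\<close>, since the overlap is the ratio of the sum of the
  squared edge probabilities to their sum.
\<close>

section \<open>Cauchy-Schwarz inequalities for triangles, with integrals and with sums\<close>

text \<open>Integrating over \<open>z\<close> first leaves a function \<open>c\<close> of
  \<open>(x, y)\<close>. Cauchy-Schwarz on the product of \<open>M1\<close> and \<open>M2\<close>
  separates \<open>f\<close> from \<open>c\<close>. Cauchy-Schwarz in \<open>z\<close> then bounds
  the square of \<open>c\<close> by a function of \<open>y\<close> times a function of
  \<open>x\<close>, and the integral of such a product factors. Working with nonnegative integrals
  avoids integrability conditions on \<open>f\<close>, \<open>g\<close> and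
  \<open>h\<close>.\<close>

lemma nn_integral_triangle_le:
  assumes "sigma_finite_measure M2" "sigma_finite_measure M3"
    and [measurable]: "f \<in> borel_measurable (M1 \<Otimes>\<^sub>M M2)" "g \<in> borel_measurable (M2 \<Otimes>\<^sub>M M3)"
      "h \<in> borel_measurable (M1 \<Otimes>\<^sub>M M3)"
  shows "(\<integral>\<^sup>+x. \<integral>\<^sup>+y. \<integral>\<^sup>+z. f (x, y) * g (y, z) * h (x, z) \<partial>M3 \<partial>M2 \<partial>M1)\<^sup>2
    \<le> (\<integral>\<^sup>+x. \<integral>\<^sup>+y. (f (x, y))\<^sup>2 \<partial>M2 \<partial>M1) * (\<integral>\<^sup>+y. \<integral>\<^sup>+z. (g (y, z))\<^sup>2 \<partial>M3 \<partial>M2)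
        * (\<integral>\<^sup>+x. \<integral>\<^sup>+z. (h (x, z))\<^sup>2 \<partial>M3 \<partial>M1)"
proof -
  interpret M2: sigma_finite_measure M2 by fact
  interpret M3: sigma_finite_measure M3 by fact
  define c where "c = (\<lambda>(x, y). \<integral>\<^sup>+z. g (y, z) * h (x, z) \<partial>M3)"
  have [measurable]: "c \<in> borel_measurable (M1 \<Otimes>\<^sub>M M2)"
    unfolding c_def by measurable
  have "(\<integral>\<^sup>+x. \<integral>\<^sup>+y. \<integral>\<^sup>+z. f (x, y) * g (y, z) * h (x, z) \<partial>M3 \<partial>M2 \<partial>M1)
      = (\<integral>\<^sup>+x. \<integral>\<^sup>+y. f (x, y) * c (x, y) \<partial>M2 \<partial>M1)"
    by (auto simp: c_def nn_integral_cmult mult.assoc intro!: nn_integral_cong)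
  also have "\<dots> = (\<integral>\<^sup>+p. f p * c p \<partial>(M1 \<Otimes>\<^sub>M M2))"
    by (rule M2.nn_integral_fst) measurable
  also have "\<dots>\<^sup>2 \<le> (\<integral>\<^sup>+p. (f p)\<^sup>2 \<partial>(M1 \<Otimes>\<^sub>M M2)) * (\<integral>\<^sup>+p. (c p)\<^sup>2 \<partial>(M1 \<Otimes>\<^sub>M M2))"
    by (rule Cauchy_Schwarz_nn_integral) measurable
  also have "(\<integral>\<^sup>+p. (f p)\<^sup>2 \<partial>(M1 \<Otimes>\<^sub>M M2)) = (\<integral>\<^sup>+x. \<integral>\<^sup>+y. (f (x, y))\<^sup>2 \<partial>M2 \<partial>M1)"
    by (rule M2.nn_integral_fst[symmetric]) measurable
  also have "(\<integral>\<^sup>+p. (c p)\<^sup>2 \<partial>(M1 \<Otimes>\<^sub>M M2)) = (\<integral>\<^sup>+x. \<integral>\<^sup>+y. (c (x, y))\<^sup>2 \<partial>M2 \<partial>M1)"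
    by (rule M2.nn_integral_fst[symmetric]) measurable
  also have "\<dots> \<le> (\<integral>\<^sup>+x. \<integral>\<^sup>+y. (\<integral>\<^sup>+z. (g (y, z))\<^sup>2 \<partial>M3) * (\<integral>\<^sup>+z. (h (x, z))\<^sup>2 \<partial>M3) \<partial>M2 \<partial>M1)"
    unfolding c_def prod.case
    by (intro nn_integral_mono Cauchy_Schwarz_nn_integral) measurable
  also have "\<dots> = (\<integral>\<^sup>+y. \<integral>\<^sup>+z. (g (y, z))\<^sup>2 \<partial>M3 \<partial>M2) * (\<integral>\<^sup>+x. \<integral>\<^sup>+z. (h (x, z))\<^sup>2 \<partial>M3 \<partial>M1)"
    by (simp add: nn_integral_multc nn_integral_cmult)
  finally show ?thesis
    by (simp add: mult.assoc mult_left_mono)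
qed

text \<open>The argument of \<open>nn_integral_triangle_le\<close> with sums in place of integrals:
  \<open>c\<close> collects the sum over \<open>z\<close>, and Cauchy-Schwarz is applied once to
  pairs \<open>(x, y)\<close> and once to \<open>z\<close>.\<close>

lemma sum_triangle_le:
  fixes f :: "'a \<Rightarrow> 'b \<Rightarrow> real"
  shows "(\<Sum>x\<in>X. \<Sum>y\<in>Y. \<Sum>z\<in>Z. f x y * g y z * h x z)\<^sup>2
    \<le> (\<Sum>x\<in>X. \<Sum>y\<in>Y. (f x y)\<^sup>2) * (\<Sum>y\<in>Y. \<Sum>z\<in>Z. (g y z)\<^sup>2) * (\<Sum>x\<in>X. \<Sum>z\<in>Z. (h x z)\<^sup>2)"
proof -
  define c where "c = (\<lambda>(x, y). \<Sum>z\<in>Z. g y z * h x z)"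
  have "(\<Sum>x\<in>X. \<Sum>y\<in>Y. \<Sum>z\<in>Z. f x y * g y z * h x z) = (\<Sum>p\<in>X\<times>Y. case_prod f p * c p)"
    by (simp add: c_def sum.cartesian_product' sum_distrib_left mult.assoc)
  also have "\<dots>\<^sup>2 \<le> (\<Sum>p\<in>X\<times>Y. (case_prod f p)\<^sup>2) * (\<Sum>p\<in>X\<times>Y. (c p)\<^sup>2)"
    by (rule Cauchy_Schwarz_ineq_sum)
  also have "\<dots> \<le> (\<Sum>p\<in>X\<times>Y. (case_prod f p)\<^sup>2) *
      (\<Sum>(x, y)\<in>X\<times>Y. (\<Sum>z\<in>Z. (g y z)\<^sup>2) * (\<Sum>z\<in>Z. (h x z)\<^sup>2))"
    by (intro mult_left_mono sum_mono sum_nonneg)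
      (auto simp: c_def Cauchy_Schwarz_ineq_sum)
  also have "(\<Sum>(x, y)\<in>X\<times>Y. (\<Sum>z\<in>Z. (g y z)\<^sup>2) * (\<Sum>z\<in>Z. (h x z)\<^sup>2))
      = (\<Sum>y\<in>Y. \<Sum>z\<in>Z. (g y z)\<^sup>2) * (\<Sum>x\<in>X. \<Sum>z\<in>Z. (h x z)\<^sup>2)"
    by (simp add: sum.cartesian_product' flip: sum_distrib_left sum_distrib_right)
  finally show ?thesis
    by (simp add: sum.cartesian_product' mult.assoc)
qed

section \<open>Passing from independent embeddings to products of their laws\<close>

context prob_space
begin

text \<open>Independence says that the joint law of the variables indexed by \<open>J\<close> is the
  product of their laws. Since the three indices are distinct, this product has three separate
  coordinates, and Fubini's theorem peels them off one at a time.\<close>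

lemma nn_integral_indep_vars_triple:
  assumes indep: "indep_vars (\<lambda>_. E) x I"
    and ijk: "i \<in> I" "j \<in> I" "k \<in> I" "i \<noteq> j" "j \<noteq> k" "i \<noteq> k"
    and F: "F \<in> borel_measurable (E \<Otimes>\<^sub>M E \<Otimes>\<^sub>M E)"
  shows "(\<integral>\<^sup>+w. F (x i w, x j w, x k w) \<partial>M)
    = (\<integral>\<^sup>+a. \<integral>\<^sup>+b. \<integral>\<^sup>+c. F (a, b, c) \<partial>distr M E (x k) \<partial>distr M E (x j) \<partial>distr M E (x i))"
proof -
  define J where "J = {i, j, k}"
  \<comment> \<open>\<open>x\<close> need not be measurable outside \<open>I\<close>, but a product measure wants a full family of factors.\<close>
  define y where "y l = (if l \<in> J then x l else x i)" for l
  note F[measurable]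
  have x_meas: "x l \<in> measurable M E" if "l \<in> J" for l
    using indep ijk that by (auto simp: indep_vars_def J_def)
  then have y_meas[measurable]: "y l \<in> measurable M E" for l
    using x_meas[of i] by (auto simp: y_def J_def)
  define D where "D l = distr M E (y l)" for l
  have [measurable_cong]: "sets (D l) = sets E" and [simp]: "space (D l) = space E" for l
    by (simp_all add: D_def)
  interpret D: product_prob_space D UNIV
    by (intro product_prob_spaceI) (simp add: D_def prob_space_distr)
  have "indep_vars (\<lambda>_. E) x J"
    by (rule indep_vars_subset[OF indep]) (use ijk in \<open>auto simp: J_def\<close>)
  then have "indep_vars (\<lambda>_. E) y J"
    by (subst indep_vars_cong[of J J y x]) (auto simp: y_def)
  then have distr: "distr M (PiM J (\<lambda>_. E)) (\<lambda>w. \<lambda>l\<in>J. y l w) = PiM J D"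
    by (subst (asm) indep_vars_iff_distr_eq_PiM) (auto simp: J_def D_def[abs_def])
  have [measurable]: "i \<in> J" "j \<in> J" "k \<in> J" by (auto simp: J_def)
  have y_restr: "(\<lambda>w. \<lambda>l\<in>J. y l w) \<in> measurable M (PiM J (\<lambda>_. E))"
    by (intro measurable_restrict y_meas)
  have "(\<integral>\<^sup>+w. F (x i w, x j w, x k w) \<partial>M)
      = (\<integral>\<^sup>+s. F (s i, s j, s k) \<partial>distr M (PiM J (\<lambda>_. E)) (\<lambda>w. \<lambda>l\<in>J. y l w))"
    by (subst nn_integral_distr[OF y_restr]) (measurable, simp add: y_def J_def)
  also have "\<dots> = (\<integral>\<^sup>+s. F (s i, s j, s k) \<partial>PiM {i, j, k} D)"
    unfolding distr by (simp add: J_def)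
  also have "\<dots> = (\<integral>\<^sup>+a. \<integral>\<^sup>+s. F (a, s j, s k) \<partial>PiM {j, k} D \<partial>D i)"
    using ijk by (subst D.product_nn_integral_insert_rev) simp_all
  also have "\<dots> = (\<integral>\<^sup>+a. \<integral>\<^sup>+b. \<integral>\<^sup>+s. F (a, b, s k) \<partial>PiM {k} D \<partial>D j \<partial>D i)"
    using ijk by (intro nn_integral_cong, subst D.product_nn_integral_insert_rev) simp_all
  also have "\<dots> = (\<integral>\<^sup>+a. \<integral>\<^sup>+b. \<integral>\<^sup>+c. F (a, b, c) \<partial>D k \<partial>D j \<partial>D i)"
    by (intro nn_integral_cong, subst D.product_nn_integral_singleton) simp_all
  finally show ?thesis
    by (simp add: D_def y_def J_def)
qed

lemma nn_integral_indep_vars_triangle_le: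
  assumes indep: "indep_vars (\<lambda>_. E) x I"
    and ijk: "i \<in> I" "j \<in> I" "k \<in> I" "i \<noteq> j" "j \<noteq> k" "i \<noteq> k"
    and [measurable]: "f \<in> borel_measurable (E \<Otimes>\<^sub>M E)" "g \<in> borel_measurable (E \<Otimes>\<^sub>M E)"
      "h \<in> borel_measurable (E \<Otimes>\<^sub>M E)"
  shows "(\<integral>\<^sup>+w. f (x i w, x j w) * g (x j w, x k w) * h (x i w, x k w) \<partial>M)\<^sup>2
    \<le> (\<integral>\<^sup>+w. (f (x i w, x j w))\<^sup>2 \<partial>M) * (\<integral>\<^sup>+w. (g (x j w, x k w))\<^sup>2 \<partial>M)
        * (\<integral>\<^sup>+w. (h (x i w, x k w))\<^sup>2 \<partial>M)"
proof -
  have x_meas: "x l \<in> measurable M E" if "l \<in> I" for l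
    using indep that by (auto simp: indep_vars_def)
  note [measurable] = x_meas[OF ijk(1)] x_meas[OF ijk(2)] x_meas[OF ijk(3)]
  interpret i: prob_space "distr M E (x i)" by (rule prob_space_distr) simp
  interpret j: prob_space "distr M E (x j)" by (rule prob_space_distr) simp
  interpret k: prob_space "distr M E (x k)" by (rule prob_space_distr) simp
  \<comment> \<open>Each squared factor depends on only two of the three embeddings. It is treated
    as a function of all three, and integrating out the third against a probability law contributes
    a factor 1.\<close>
  note triple = nn_integral_indep_vars_triple[OF indep ijk]
  show ?thesis
    using nn_integral_triangle_le[OF j.sigma_finite_measure_axioms k.sigma_finite_measure_axioms,
        of f "distr M E (x i)" g h]
      triple[of "\<lambda>(a, b, c). f (a, b) * g (b, c) * h (a, c)"]
      triple[of "\<lambda>(a, b, c). (f (a, b))\<^sup>2"] triple[of "\<lambda>(a, b, c). (g (b, c))\<^sup>2"]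
      triple[of "\<lambda>(a, b, c). (h (a, c))\<^sup>2"]
    by (simp add: i.emeasure_space_1[simplified] j.emeasure_space_1[simplified]
        k.emeasure_space_1[simplified] cong: measurable_cong_sets)
qed

end

section \<open>Finiteness of the set of graphs and counting of triangles\<close>

text \<open>A 0/1 matrix is determined by the positions of its ones, and these lie in a finite
  square. The result makes the support of a graph model finite, so that every function is integrable
  and expectations commute with sums.\<close>

lemma finite_graphs: "finite (graphs n)"
proof (rule finite_imageD)
  let ?edges = "\<lambda>a. {p. case_prod a p = (1 :: nat)}"
  have "?edges a \<subseteq> {1..n} \<times> {1..n}" if "a \<in> graphs n" for a
  proof
    fix p assume p: "p \<in> ?edges a"
    have "a i j = 0" if "i \<notin> {1..n} \<or> j \<notin> {1..n}" for i j
      using that \<open>a \<in> graphs n\<close> unfolding graphs_def by blast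
    from this[of "fst p" "snd p"] p show "p \<in> {1..n} \<times> {1..n}"
      by (auto simp: case_prod_unfold mem_Times_iff)
  qed
  then have "?edges ` graphs n \<subseteq> Pow ({1..n} \<times> {1..n})"
    by blast
  then show "finite (?edges ` graphs n)"
    by (rule finite_subset) simp
  show "inj_on ?edges (graphs n)"
  proof (intro inj_onI ext)
    fix a b i j
    assume ab: "a \<in> graphs n" "b \<in> graphs n" and eq: "?edges a = ?edges b"
    have "(i, j) \<in> ?edges a \<longleftrightarrow> (i, j) \<in> ?edges b"
      by (simp only: eq)
    moreover have "a i j \<in> {0, 1}" "b i j \<in> {0, 1}"
      using ab by (simp_all add: graphs_def)
    ultimately show "a i j = b i j" by auto
  qed
qed

text \<open>The square splits into the pairs above the diagonal, their mirror images and the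
  diagonal. This translates the sums over \<open>i < j\<close> in volume and overlap into sums over
  all ordered pairs, to which Cauchy-Schwarz applies.\<close>

lemma sum_node_pairs:
  fixes f :: "nat \<Rightarrow> nat \<Rightarrow> real"
  assumes sym: "\<And>i j. f i j = f j i" and diag: "\<And>i. f i i = 0"
  shows "(\<Sum>i=1..n. \<Sum>j=1..n. f i j) = 2 * (\<Sum>(i, j)\<in>node_pairs n. f i j)"
proof -
  let ?S = "{1..n} \<times> {1..n}"
  let ?U = "node_pairs n" and ?L = "prod.swap ` node_pairs n" and ?D = "(\<lambda>i. (i, i)) ` {1..n}"
  have fin: "finite ?U"
    by (rule finite_subset[of _ ?S]) (auto simp: node_pairs_def)
  have "(\<Sum>i=1..n. \<Sum>j=1..n. f i j) = sum (case_prod f) ?S"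
    by (simp add: sum.cartesian_product')
  also have "?S = (?U \<union> ?L) \<union> ?D"
    by (auto simp: node_pairs_def image_iff)
  also have "sum (case_prod f) \<dots> = sum (case_prod f) (?U \<union> ?L) + sum (case_prod f) ?D"
    using fin by (intro sum.union_disjoint) (auto simp: node_pairs_def)
  also have "sum (case_prod f) (?U \<union> ?L) = sum (case_prod f) ?U + sum (case_prod f) ?L"
    using fin by (intro sum.union_disjoint) (auto simp: node_pairs_def)
  also have "sum (case_prod f) ?L = sum (case_prod f) ?U"
    by (subst sum.reindex) (auto simp: sym intro!: sum.cong)
  also have "sum (case_prod f) ?D = 0"
    by (rule sum.neutral) (auto simp: diag)
  finally show ?thesis by simp
qed

text \<open>The right-hand side counts ordered triples of pairwise adjacent nodes, and every
  triangle supplies the six orderings of its nodes.\<close>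

lemma card_triangles_le:
  assumes a: "a \<in> graphs n"
  shows "6 * real (card (triangles n a))
    \<le> (\<Sum>i=1..n. \<Sum>j=1..n. \<Sum>k=1..n. real (a i j) * real (a j k) * real (a i k))"
proof -
  let ?S = "{1..n} \<times> {1..n} \<times> {1..n}"
  define Q where "Q = {(i, j, k) \<in> ?S. a i j = 1 \<and> a j k = 1 \<and> a i k = 1}"
  define orderings where
    "orderings T = {(u, v, w). u \<noteq> v \<and> v \<noteq> w \<and> u \<noteq> w \<and> T = {u, v, w}}" for T :: "nat set"
  have finQ: "finite Q"
    by (rule finite_subset[of _ ?S]) (auto simp: Q_def)
  have sub: "(\<Union>T\<in>triangles n a. orderings T) \<subseteq> Q"
    by (auto simp: Q_def orderings_def triangles_def)
  have fintri: "finite (triangles n a)"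
    by (rule finite_subset[of _ "Pow {1..n}"]) (auto simp: triangles_def)
  have card6: "card (orderings T) = 6" if "T \<in> triangles n a" for T
  proof -
    have "card T = 3" using that by (simp add: triangles_def)
    then obtain p q r where T: "T = {p, q, r}" and d: "p \<noteq> q" "q \<noteq> r" "p \<noteq> r"
      by (auto simp: card_3_iff)
    have "orderings T = {(p, q, r), (p, r, q), (q, p, r), (q, r, p), (r, p, q), (r, q, p)}"
      (is "_ = ?P")
    proof (intro equalityI subsetI)
      fix t assume "t \<in> orderings T"
      then obtain u v w where t: "t = (u, v, w)" "u \<noteq> v" "v \<noteq> w" "u \<noteq> w" "{p, q, r} = {u, v, w}"
        by (auto simp: orderings_def T)
      then have "u = p \<or> u = q \<or> u = r" "v = p \<or> v = q \<or> v = r" "w = p \<or> w = q \<or> w = r"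
        by blast+
      with t(1-4) show "t \<in> ?P" by auto
    next
      fix t assume "t \<in> ?P"
      then show "t \<in> orderings T"
        unfolding orderings_def T using d by (elim insertE emptyE) (simp_all add: insert_commute)
    qed
    then show ?thesis using d by simp
  qed
  have "6 * card (triangles n a) = (\<Sum>T\<in>triangles n a. card (orderings T))"
    by (simp add: card6)
  also have "\<dots> = card (\<Union>T\<in>triangles n a. orderings T)"
    \<comment> \<open>An ordered triple determines its set of entries, so different triangles have
      disjoint sets of orderings. Each of these sets is finite because its cardinality 6 is
      nonzero.\<close>
    using fintri card6 by (intro card_UN_disjoint[symmetric] ballI)
      (auto simp: orderings_def intro: card_ge_0_finite)
  also have "\<dots> \<le> card Q"
    by (rule card_mono[OF finQ sub])
  finally have "6 * real (card (triangles n a)) \<le> real (card Q)"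
    by (simp flip: of_nat_le_iff)
  also have "\<dots> = (\<Sum>(i, j, k)\<in>Q. real (a i j) * real (a j k) * real (a i k))"
    by (auto simp: card_eq_sum Q_def intro!: sum.cong simp del: sum_constant)
  also have "\<dots> = (\<Sum>(i, j, k)\<in>?S. real (a i j) * real (a j k) * real (a i k))"
  proof (rule sum.mono_neutral_left)
    show "\<forall>t\<in>?S - Q. (case t of (i, j, k) \<Rightarrow> real (a i j) * real (a j k) * real (a i k)) = 0"
    proof clarify
      fix i j k assume "(i, j, k) \<notin> Q" "i \<in> {1..n}" "j \<in> {1..n}" "k \<in> {1..n}"
      moreover have "a i j \<in> {0, 1}" "a j k \<in> {0, 1}" "a i k \<in> {0, 1}"
        using a by (simp_all add: graphs_def)
      ultimately show "real (a i j) * real (a j k) * real (a i k) = 0"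
        by (auto simp: Q_def)
    qed
  qed (auto simp: Q_def)
  finally show ?thesis by (simp add: sum.cartesian_product')
qed

section \<open>Edge and triangle probabilities in a node independent model\<close>

text \<open>For a graph model the entries are 0 or 1, so this expectation is the probability of an
  edge. Written as an expectation, it is accessible to linearity.\<close>

definition edge_prob :: "adj_matrix pmf \<Rightarrow> nat \<Rightarrow> nat \<Rightarrow> real" where
  "edge_prob A i j = measure_pmf.expectation A (\<lambda>a. real (a i j))"

text \<open>For a graph model and distinct nodes this is the probability that they form a triangle.
  It vanishes when two nodes coincide, because the diagonal is zero.\<close>

definition triple_prob :: "adj_matrix pmf \<Rightarrow> nat \<Rightarrow> nat \<Rightarrow> nat \<Rightarrow> real" where
  "triple_prob A i j k =
    measure_pmf.expectation A (\<lambda>a. real (a i j) * real (a j k) * real (a i k))"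

text \<open>The model prescribes conditional edge probabilities and conditional independence only
  for pairs \<open>i < j\<close>, hence the ordered nodes. Given the embeddings, the three edges are
  independent, so averaging turns the triangle probability into the integral of a product of three
  values of \<open>e\<close>, which \<open>nn_integral_indep_vars_triangle_le\<close>
  bounds.\<close>

lemma triple_prob_ordered_le:
  assumes ni: "node_independent n M E A" and ijk: "i < j" "j < k" "i \<in> {1..n}" "k \<in> {1..n}"
  shows "(triple_prob A i j k)\<^sup>2 \<le> edge_prob A i j * edge_prob A j k * edge_prob A i k"
proof -
  from ni interpret prob_space M by (simp add: node_independent_def)
  from ni obtain x e G where gm: "graph_model n A"
    and indep: "indep_vars (\<lambda>_. E) x {1..n}"
    and e_meas[measurable]: "case_prod e \<in> borel_measurable (E \<Otimes>\<^sub>M E)"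
    and e01: "\<And>u v. u \<in> space E \<Longrightarrow> v \<in> space E \<Longrightarrow> e u v \<in> {0..1}"
    and G[measurable]: "G \<in> measurable M (count_space UNIV)"
    and distr: "distr M (count_space UNIV) G = measure_pmf A"
    and edge: "\<And>u v. (u, v) \<in> node_pairs n \<Longrightarrow>
      AE w in M. cond_prob_given M (generated_algebra M E x {1..n}) {w \<in> space M. G w u v = 1} w
        = e (x u w) (x v w)"
    and cond: "cond_indep_vars M (generated_algebra M E x {1..n}) (\<lambda>_. count_space UNIV)
      (\<lambda>(i, j) w. G w i j) (node_pairs n)"
    unfolding node_independent_def by fast
  define F where "F = generated_algebra M E x {1..n}"
  have x_meas: "x l \<in> measurable M E" if "l \<in> {1..n}" for l
    using indep that by (auto simp: indep_vars_def)
  have "(\<lambda>w. \<lambda>l\<in>{1..n}. x l w) \<in> measurable M (PiM {1..n} (\<lambda>_. E))"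
    by (intro measurable_restrict x_meas)
  \<comment> \<open>Measurability of the tuple of embeddings puts the sigma-algebra it generates
    inside that of \<open>M\<close>, as conditional expectation requires.\<close>
  then have "subalgebra M F"
    by (simp add: F_def generated_algebra_def subalgebra_def measurable_iff_sets)
  then interpret finite_measure_subalgebra M F by unfold_locales
  \<comment> \<open>The defining property of conditional expectation, integrated over the whole
    space.\<close>
  have prob_cond: "prob S = (\<integral>w. cond_prob_given M F S w \<partial>M)" if [measurable]: "S \<in> sets M" for S
    unfolding cond_prob_given_def
    by (subst real_cond_exp_int) (auto simp: emeasure_eq_measure)
  define ev where "ev = (\<lambda>(u, v). {w \<in> space M. G w u v = 1})"
  have ev_meas: "ev p \<in> sets M" for p
  proof -
    have "ev p = G -` {a. a (fst p) (snd p) = 1} \<inter> space M"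
      by (auto simp: ev_def case_prod_unfold)
    also have "\<dots> \<in> sets M"
      by (rule measurable_sets[OF G]) simp
    finally show ?thesis .
  qed
  \<comment> \<open>Transfers expectations under \<open>A\<close> to probabilities on
    \<open>M\<close>. Since \<open>A\<close> lives on \<open>graphs n\<close>, it is enough that
    \<open>f\<close> agrees there with the indicator of \<open>Q\<close>.\<close>
  have prob_G: "measure_pmf.expectation A f = prob {w \<in> space M. G w \<in> Q}"
    if f: "\<And>a. a \<in> graphs n \<Longrightarrow> f a = (if a \<in> Q then 1 else 0)" for f :: "adj_matrix \<Rightarrow> real" and Q
  proof -
    have "measure_pmf.expectation A f = measure_pmf.expectation A (indicator Q)"
      using gm f by (intro integral_cong_AE)
        (auto simp: AE_measure_pmf_iff graph_model_def indicator_def)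
    also have "\<dots> = measure (distr M (count_space UNIV) G) Q"
      unfolding distr by simp
    also have "\<dots> = prob {w \<in> space M. G w \<in> Q}"
      by (subst measure_distr) (auto intro!: arg_cong[where f = prob])
    finally show ?thesis .
  qed
  have edge01: "a u v \<in> {0, 1}" if "a \<in> graphs n" for a u v
    using that unfolding graphs_def by blast
  have pairs: "(i, j) \<in> node_pairs n" "(j, k) \<in> node_pairs n" "(i, k) \<in> node_pairs n"
    and nodes: "j \<in> {1..n}"
    using ijk by (auto simp: node_pairs_def)
  note [measurable] = x_meas[OF ijk(3)] x_meas[OF ijk(4)] x_meas[OF nodes]
  have e_x: "e (x u w) (x v w) \<in> {0..1}" if "w \<in> space M" "u \<in> {1..n}" "v \<in> {1..n}" for u v w
    using that x_meas by (intro e01) (auto dest: measurable_space)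
  have edge_prob_eq: "ennreal (edge_prob A u v) = (\<integral>\<^sup>+w. ennreal (e (x u w) (x v w)) \<partial>M)"
    if uv: "(u, v) \<in> node_pairs n" for u v
  proof -
    have "u \<in> {1..n}" "v \<in> {1..n}" using uv by (auto simp: node_pairs_def)
    note [measurable] = x_meas[OF this(1)] x_meas[OF this(2)] and e_uv = e_x[OF _ this]
    have "edge_prob A u v = prob {w \<in> space M. G w \<in> {a. a u v = 1}}"
      unfolding edge_prob_def by (rule prob_G) (use edge01 in fastforce)
    also have "\<dots> = (\<integral>w. cond_prob_given M F (ev (u, v)) w \<partial>M)"
      using prob_cond[OF ev_meas[of "(u, v)"]] by (simp add: ev_def)
    also have "\<dots> = (\<integral>w. e (x u w) (x v w) \<partial>M)"
      using edge[OF uv] by (intro integral_cong_AE) (auto simp: ev_def F_def cond_prob_given_def)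
    also have "ennreal \<dots> = (\<integral>\<^sup>+w. ennreal (e (x u w) (x v w)) \<partial>M)"
      using e_uv by (intro nn_integral_eq_integral[symmetric] integrable_const_bound[where B = 1])
        auto
    finally show ?thesis .
  qed
  have triple_prob_eq: "ennreal (triple_prob A i j k) =
    (\<integral>\<^sup>+w. ennreal (e (x i w) (x j w)) * ennreal (e (x j w) (x k w)) * ennreal (e (x i w) (x k w)) \<partial>M)"
  proof -
    let ?J = "{(i, j), (j, k), (i, k)}"
    have "?J \<subseteq> node_pairs n" using pairs by simp
    \<comment> \<open>Conditional independence is instantiated with the event \<open>{1}\<close> for
      each of the three entries.\<close>
    with cond have "AE w in M. cond_prob_given M F
          (\<Inter>p\<in>?J. (\<lambda>w. case p of (i, j) \<Rightarrow> G w i j) -` {1} \<inter> space M) w =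
        (\<Prod>p\<in>?J. cond_prob_given M F ((\<lambda>w. case p of (i, j) \<Rightarrow> G w i j) -` {1} \<inter> space M) w)"
      unfolding cond_indep_vars_def F_def[symmetric]
      by (elim conjE allE[of _ ?J] allE[of _ "\<lambda>_. {1}"]) (auto simp: case_prod_unfold)
    moreover have "(\<lambda>w. case p of (i, j) \<Rightarrow> G w i j) -` {1} \<inter> space M = ev p" for p
      by (auto simp: ev_def split: prod.splits)
    ultimately have "AE w in M. cond_prob_given M F (\<Inter>p\<in>?J. ev p) w
        = (\<Prod>p\<in>?J. cond_prob_given M F (ev p) w)"
      by (simp only:)
    \<comment> \<open>As \<open>i < j < k\<close>, the three pairs are distinct, so the product over
      \<open>?J\<close> really has three factors.\<close>
    with edge[OF pairs(1)] edge[OF pairs(2)] edge[OF pairs(3)]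
    have ae: "AE w in M. cond_prob_given M F (\<Inter>p\<in>?J. ev p) w
        = e (x i w) (x j w) * e (x j w) (x k w) * e (x i w) (x k w)"
      by eventually_elim (use ijk in \<open>simp add: ev_def F_def mult.assoc\<close>)
    have "triple_prob A i j k = prob {w \<in> space M. G w \<in> {a. a i j = 1 \<and> a j k = 1 \<and> a i k = 1}}"
      unfolding triple_prob_def
    proof (rule prob_G)
      fix a assume "a \<in> graphs n"
      then have "a i j \<in> {0, 1}" "a j k \<in> {0, 1}" "a i k \<in> {0, 1}" by (fact edge01)+
      then show "real (a i j) * real (a j k) * real (a i k) =
          (if a \<in> {a. a i j = 1 \<and> a j k = 1 \<and> a i k = 1} then 1 else 0)" by auto
    qed
    also have "{w \<in> space M. G w \<in> {a. a i j = 1 \<and> a j k = 1 \<and> a i k = 1}} = (\<Inter>p\<in>?J. ev p)"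
      by (auto simp: ev_def)
    also have "prob (\<Inter>p\<in>?J. ev p) = (\<integral>w. cond_prob_given M F (\<Inter>p\<in>?J. ev p) w \<partial>M)"
      by (rule prob_cond) (use ev_meas in auto)
    also have "\<dots> = (\<integral>w. e (x i w) (x j w) * e (x j w) (x k w) * e (x i w) (x k w) \<partial>M)"
      by (rule integral_cong_AE) (use ae in \<open>auto simp: cond_prob_given_def\<close>)
    also have "ennreal \<dots> = (\<integral>\<^sup>+w. ennreal (e (x i w) (x j w) * e (x j w) (x k w) * e (x i w) (x k w)) \<partial>M)"
      using e_x ijk nodes
      by (intro nn_integral_eq_integral[symmetric] integrable_const_bound[where B = 1])
        (auto simp: abs_mult intro!: mult_le_one)
    also have "\<dots> = (\<integral>\<^sup>+w. ennreal (e (x i w) (x j w)) * ennreal (e (x j w) (x k w)) * ennreal (e (x i w) (x k w)) \<partial>M)"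
      using e_x ijk nodes by (intro nn_integral_cong) (simp add: ennreal_mult)
    finally show ?thesis .
  qed
  have sq_le: "(\<integral>\<^sup>+w. (ennreal (e (x u w) (x v w)))\<^sup>2 \<partial>M) \<le> ennreal (edge_prob A u v)"
    if uv: "(u, v) \<in> node_pairs n" for u v
    unfolding edge_prob_eq[OF uv]
  proof (rule nn_integral_mono)
    fix w assume "w \<in> space M"
    then have "e (x u w) (x v w) \<in> {0..1}" using uv by (intro e_x) (auto simp: node_pairs_def)
    then show "(ennreal (e (x u w) (x v w)))\<^sup>2 \<le> ennreal (e (x u w) (x v w))"
      by (auto simp: ennreal_power power2_eq_square mult_left_le ennreal_leI simp flip: ennreal_mult)
  qed
  let ?f = "\<lambda>(u, v). ennreal (e u v)"
  have nonneg: "0 \<le> edge_prob A u v" for u v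
    unfolding edge_prob_def by simp
  have nonneg3: "0 \<le> triple_prob A i j k"
    unfolding triple_prob_def by simp
  have "(ennreal (triple_prob A i j k))\<^sup>2
      \<le> (\<integral>\<^sup>+w. (ennreal (e (x i w) (x j w)))\<^sup>2 \<partial>M) * (\<integral>\<^sup>+w. (ennreal (e (x j w) (x k w)))\<^sup>2 \<partial>M)
        * (\<integral>\<^sup>+w. (ennreal (e (x i w) (x k w)))\<^sup>2 \<partial>M)"
    using nn_integral_indep_vars_triangle_le[OF indep ijk(3) nodes ijk(4), of ?f ?f ?f] ijk
    unfolding triple_prob_eq by simp
  also have "\<dots> \<le> ennreal (edge_prob A i j) * ennreal (edge_prob A j k) * ennreal (edge_prob A i k)"
    by (intro mult_mono sq_le pairs) auto
  finally show ?thesis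
    using nonneg nonneg3 by (simp add: ennreal_power flip: ennreal_mult)
qed

lemma edge_prob_sym:
  assumes "graph_model n A"
  shows "edge_prob A i j = edge_prob A j i"
  unfolding edge_prob_def using assms
  by (intro integral_cong_AE) (auto simp: AE_measure_pmf_iff graph_model_def graphs_def subset_iff)

lemma edge_prob_diag:
  assumes "graph_model n A"
  shows "edge_prob A i i = 0"
  unfolding edge_prob_def using assms
  by (intro integral_eq_zero_AE) (auto simp: AE_measure_pmf_iff graph_model_def graphs_def)

text \<open>These two adjacent transpositions generate all permutations of three nodes, which is
  enough to sort any triple.\<close>

lemma triple_prob_swap:
  assumes "graph_model n A"
  shows "triple_prob A i j k = triple_prob A j i k" "triple_prob A i j k = triple_prob A i k j"
  unfolding triple_prob_def using assms
  by (intro integral_cong_AE;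
      force simp: AE_measure_pmf_iff graph_model_def graphs_def subset_iff)+

text \<open>Both sides are symmetric in the nodes, so distinct nodes may be put in increasing order.
  If two nodes coincide, the product contains a diagonal entry and the left-hand side is 0.\<close>

lemma triple_prob_le:
  assumes ni: "node_independent n M E A" and ijk: "i \<in> {1..n}" "j \<in> {1..n}" "k \<in> {1..n}"
  shows "(triple_prob A i j k)\<^sup>2 \<le> edge_prob A i j * edge_prob A j k * edge_prob A i k"
proof (cases "i \<noteq> j \<and> j \<noteq> k \<and> i \<noteq> k")
  case True
  have gm: "graph_model n A" using ni by (simp add: node_independent_def)
  note swap = triple_prob_swap[OF gm] and sym = edge_prob_sym[OF gm]
  note ordered = triple_prob_ordered_le[OF ni]
  consider "i < j" "j < k" | "i < k" "k < j" | "j < i" "i < k" | "j < k" "k < i"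
    | "k < i" "i < j" | "k < j" "j < i"
    using True by linarith
  then show ?thesis
  proof cases
    case 1 then show ?thesis using ordered[of i j k] ijk by simp
  next
    case 2 then show ?thesis using ordered[of i k j] ijk
      by (simp add: swap(2)[of i k j] sym[of k j] mult_ac)
  next
    case 3 then show ?thesis using ordered[of j i k] ijk
      by (simp add: swap(1)[of j i k] sym[of j i] mult_ac)
  next
    case 4 then show ?thesis using ordered[of j k i] ijk
      by (simp add: swap(2)[of j k i] swap(1)[of j i k] sym[of j i] sym[of k i] mult_ac)
  next
    case 5 then show ?thesis using ordered[of k i j] ijk
      by (simp add: swap(1)[of k i j] swap(2)[of i k j] sym[of k i] sym[of k j] mult_ac)
  next
    case 6 then show ?thesis using ordered[of k j i] ijk
      by (simp add: swap(1)[of k j i] swap(2)[of j k i] swap(1)[of j i k] sym[of k j] sym[of j i]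
          sym[of k i] mult_ac)
  qed
next
  case False
  have gm: "graph_model n A" using ni by (simp add: node_independent_def)
  have diag: "a l l = 0" if "a \<in> set_pmf A" for a l
    using gm that by (auto simp: graph_model_def graphs_def)
  have "triple_prob A i j k = 0"
    unfolding triple_prob_def using False
    by (intro integral_eq_zero_AE) (auto simp: AE_measure_pmf_iff diag)
  then show ?thesis by (simp add: edge_prob_def)
qed

section \<open>Volume and overlap in terms of edge probabilities\<close>

lemma edge_volume_eq:
  assumes "graph_model n A"
  shows "edge_volume n A = (\<Sum>(i, j)\<in>node_pairs n. edge_prob A i j)"
proof -
  have "finite (set_pmf A)"
    using assms finite_graphs[of n] by (auto simp: graph_model_def dest: finite_subset)
  then show ?thesis
    unfolding edge_volume_def edge_prob_def case_prod_unfold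
    by (intro Bochner_Integration.integral_sum integrable_measure_pmf_finite)
qed

text \<open>For two independent samples, the expected product of the same entry factors into the
  square of the edge probability. The factorization is carried out as a double sum over the finite
  support.\<close>

lemma overlap_eq:
  assumes "graph_model n A"
  shows "overlap n A = (\<Sum>(i, j)\<in>node_pairs n. (edge_prob A i j)\<^sup>2) / edge_volume n A"
proof -
  have fin: "finite (set_pmf A)"
    using assms finite_graphs[of n] by (auto simp: graph_model_def dest: finite_subset)
  have "measure_pmf.expectation (pair_pmf A A) (\<lambda>q. real (fst q i j) * real (snd q i j))
      = (edge_prob A i j)\<^sup>2" for i j
  proof -
    have "measure_pmf.expectation (pair_pmf A A) (\<lambda>q. real (fst q i j) * real (snd q i j))
        = (\<Sum>(a, a')\<in>set_pmf A \<times> set_pmf A. (real (a i j) * pmf A a) * (real (a' i j) * pmf A a'))"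
      by (subst integral_measure_pmf_real[where A = "set_pmf A \<times> set_pmf A"])
        (auto simp: fin pmf_pair mult_ac intro!: sum.cong)
    also have "\<dots> = (edge_prob A i j)\<^sup>2"
      unfolding edge_prob_def power2_eq_square
      by (simp add: integral_measure_pmf_real[OF fin] sum_product sum.cartesian_product)
    finally show ?thesis .
  qed
  moreover have "measure_pmf.expectation (pair_pmf A A)
        (\<lambda>q. \<Sum>p\<in>node_pairs n. real (fst q (fst p) (snd p)) * real (snd q (fst p) (snd p)))
      = (\<Sum>p\<in>node_pairs n. measure_pmf.expectation (pair_pmf A A)
        (\<lambda>q. real (fst q (fst p) (snd p)) * real (snd q (fst p) (snd p))))"
    using fin by (intro Bochner_Integration.integral_sum integrable_measure_pmf_finite) simp
  ultimately show ?thesis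
    unfolding overlap_def case_prod_unfold by simp
qed

text \<open>Cauchy-Schwarz against the constant 1 over all \<open>n * n\<close> ordered pairs, where
  the diagonal contributes 0, bounds the squared sum of the edge probabilities by the square of
  \<open>n\<close> times the sum of their squares. Cancelling the positive factor
  \<open>2 * edge_volume n A\<close> leaves the claim.\<close>

lemma edge_volume_le_overlap:
  assumes gm: "graph_model n A" and vol: "edge_volume n A > 0"
  shows "2 * edge_volume n A \<le> (real n)\<^sup>2 * overlap n A"
proof -
  let ?S = "{1..n} \<times> {1..n}"
  have sum_p: "(\<Sum>p\<in>?S. case_prod (edge_prob A) p) = 2 * edge_volume n A"
    using sum_node_pairs[of "edge_prob A" n, OF edge_prob_sym[OF gm] edge_prob_diag[OF gm]]
    by (simp add: edge_volume_eq[OF gm] sum.cartesian_product')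
  have sum_p2: "(\<Sum>p\<in>?S. (case_prod (edge_prob A) p)\<^sup>2) = 2 * (overlap n A * edge_volume n A)"
    using sum_node_pairs[of "\<lambda>i j. (edge_prob A i j)\<^sup>2" n] edge_prob_sym[OF gm] edge_prob_diag[OF gm]
      vol by (simp add: overlap_eq[OF gm] sum.cartesian_product')
  have "(2 * edge_volume n A)\<^sup>2 \<le> 2 * (overlap n A * edge_volume n A) * (real n)\<^sup>2"
    using Cauchy_Schwarz_ineq_sum[of "case_prod (edge_prob A)" "\<lambda>_. 1" ?S]
    unfolding mult_1_right sum_p sum_p2 by (simp add: power2_eq_square)
  then have "(2 * edge_volume n A) * (2 * edge_volume n A)
      \<le> ((real n)\<^sup>2 * overlap n A) * (2 * edge_volume n A)"
    by (simp add: power2_eq_square mult_ac)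
  then show ?thesis
    by (rule mult_right_le_imp_le) (use vol in simp)
qed

section \<open>Assembling the bound on the expected number of triangles\<close>

theorem theorem3:
  fixes n :: nat and A :: "adj_matrix pmf" and M :: "'w measure" and E :: "'e measure"
  assumes "node_independent n M E A"
    and "edge_volume n A > 0"
  shows "measure_pmf.expectation A (\<lambda>a. real (card (triangles n a)))
           \<le> 1 / 6 * real n ^ 3 * overlap n A powr (3 / 2)"
proof -
  have gm: "graph_model n A" using assms(1) by (simp add: node_independent_def)
  have fin: "finite (set_pmf A)"
    using gm finite_graphs[of n] by (auto simp: graph_model_def dest: finite_subset)
  note int = integrable_measure_pmf_finite[OF fin]
  have p_nonneg: "0 \<le> edge_prob A i j" for i j
    by (simp add: edge_prob_def)
  \<comment> \<open>Taking roots in \<open>triple_prob_le\<close> bounds each triple by a product of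
    three values of \<open>b\<close>. This has the shape required by \<open>sum_triangle_le\<close>,
    and the squares of \<open>b\<close> sum to twice the volume.\<close>
  define b where "b i j = sqrt (edge_prob A i j)" for i j
  have b2: "(\<Sum>i=1..n. \<Sum>j=1..n. (b i j)\<^sup>2) = 2 * edge_volume n A"
    using sum_node_pairs[of "edge_prob A" n, OF edge_prob_sym[OF gm] edge_prob_diag[OF gm]]
    by (simp add: b_def p_nonneg edge_volume_eq[OF gm])
  have "6 * measure_pmf.expectation A (\<lambda>a. real (card (triangles n a)))
      = measure_pmf.expectation A (\<lambda>a. 6 * real (card (triangles n a)))"
    by simp
  also have "\<dots> \<le> measure_pmf.expectation A
      (\<lambda>a. \<Sum>i=1..n. \<Sum>j=1..n. \<Sum>k=1..n. real (a i j) * real (a j k) * real (a i k))"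
    using gm by (intro integral_mono_AE int)
      (auto simp: AE_measure_pmf_iff graph_model_def intro!: card_triangles_le[simplified])
  also have "\<dots> = (\<Sum>i=1..n. \<Sum>j=1..n. \<Sum>k=1..n. triple_prob A i j k)"
    by (simp add: triple_prob_def Bochner_Integration.integral_sum int)
  also have "\<dots> \<le> (\<Sum>i=1..n. \<Sum>j=1..n. \<Sum>k=1..n. b i j * b j k * b i k)"
    unfolding b_def
    by (intro sum_mono) (simp add: real_le_rsqrt triple_prob_le[OF assms(1)] flip: real_sqrt_mult)
  also have "\<dots> \<le> sqrt ((2 * edge_volume n A) ^ 3)"
    using sum_triangle_le[of b b b "{1..n}" "{1..n}" "{1..n}"]
    by (intro real_le_rsqrt) (simp add: b2[simplified] power3_eq_cube)
  also have "\<dots> \<le> sqrt (((real n)\<^sup>2 * overlap n A) ^ 3)"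
    using edge_volume_le_overlap[OF gm assms(2)] assms(2)
    by (intro real_sqrt_le_mono power_mono) auto
  also have "\<dots> = real n ^ 3 * overlap n A powr (3 / 2)"
  proof -
    have "0 \<le> overlap n A"
      using assms(2) by (auto simp: overlap_eq[OF gm] intro!: divide_nonneg_pos sum_nonneg)
    then have "sqrt (overlap n A ^ 3) = overlap n A powr (3 / 2)"
      \<comment> \<open>The base 0 is treated apart because \<open>powr\<close> is defined through
        the logarithm only for nonzero base and is 0 at base 0.\<close>
      by (cases "overlap n A = 0") (simp_all add: sqrt_def root_powr_inverse powr_powr flip: powr_numeral)
    moreover have "sqrt (real n ^ 6) = real n ^ 3"
      by (rule real_sqrt_unique) (simp_all flip: power_mult)
    ultimately show ?thesis
      by (simp add: real_sqrt_mult power_mult_distrib)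
  qed
  finally show ?thesis by simp
qed

end
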